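(* Let $m,n\geq 2$ be integers, and let $L:M_{m,n}(\mathbb{R})\to M_{m,n}(\mathbb{R})$ be an invertible linear map. If $L(S_{m,n})\subseteq S_{m,n}$, then there exist invertible matrices $X\in M_m(\mathbb{R})$ and $Y\in M_n(\mathbb{R})$ such that $L(A)=XAY$ for all $A\in M_{m,n}(\mathbb{R})$, where $X$ is row positive and $Y$ is inverse nonnegative. Conversely, every map of this form, i.e. $L(A)=XAY$ with $X\in M_m(\mathbb{R})$ invertible and row positive and $Y\in M_n(\mathbb{R})$ inverse nonnegative, satisfies $L(S_{m,n})\subseteq S_{m,n}$.
   Context: $M_{m,n}(\mathbb{R})$ is the space of real $m\times n$ matrices and $M_n(\mathbb{R})=M_{n,n}(\mathbb{R})$. $\mathbb{R}_+^n=\{x\in\mathbb{R}^n: x_i\geq 0 \text{ for every } i\}$ and $\mathbb{R}_{++}^n=\{x\in\mathbb{R}^n: x_i>0\text{ for every } i\}$. A matrix $A\in M_{m,n}(\mathbb{R})$ is semipositive if there exists $x\in\mathbb{R}_+^n$ such that $Ax\in\mathbb{R}_{++}^m$; $S_{m,n}$ denotes the set of all semipositive matrices in $M_{m,n}(\mathbb{R})$. A square matrix is row positive if it is entrywise nonnegative and every row contains a nonzero entry. An invertible square matrix $Y$ is inverse nonnegative if $Y^{-1}$ is entrywise nonnegative. *)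

theory Defs
  imports "HOL-Analysis.Analysis"
begin

(* An m x n real matrix is an element of real^'n^'m, with m = CARD('m) rows and n = CARD('n)
   columns; A $ i $ j is the entry in row i and column j. *)

definition nonneg_orthant :: "(real^'n) set" where
  "nonneg_orthant = {x. \<forall>i. 0 \<le> x $ i}"

definition pos_orthant :: "(real^'n) set" where
  "pos_orthant = {x. \<forall>i. 0 < x $ i}"

definition semipositive :: "real^'n^'m \<Rightarrow> bool" where
  "semipositive A \<longleftrightarrow> (\<exists>x\<in>nonneg_orthant. A *v x \<in> pos_orthant)"

definition semipositive_matrices :: "(real^'n^'m) set" where
  "semipositive_matrices = {A. semipositive A}"

definition nonneg_matrix :: "real^'n^'m \<Rightarrow> bool" where
  "nonneg_matrix A \<longleftrightarrow> (\<forall>i j. 0 \<le> A $ i $ j)"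

definition row_positive :: "real^'n^'n \<Rightarrow> bool" where
  "row_positive X \<longleftrightarrow> nonneg_matrix X \<and> (\<forall>i. \<exists>j. X $ i $ j \<noteq> 0)"

definition inverse_nonnegative :: "real^'n^'n \<Rightarrow> bool" where
  "inverse_nonnegative Y \<longleftrightarrow> invertible Y \<and> nonneg_matrix (matrix_inv Y)"

end

theory Submission
  imports Defs
begin

text \<open>
  The converse is a direct computation: if \<open>A x > 0\<close> with \<open>x \<ge> 0\<close>, then \<open>Y\<inverse> x \<ge> 0\<close> and
  \<open>X A Y (Y\<inverse> x) = X (A x) > 0\<close>.

  For the main direction, pass to the adjoint \<open>G\<close> of \<open>L\<close> with respect to the trace inner product.
  A matrix \<open>A\<close> is semipositive iff for some \<open>x \<ge> 0\<close> it has positive inner product with all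
  \<open>w x\<^sup>T\<close> where \<open>w \<ge> 0\<close>, \<open>w \<noteq> 0\<close>. Separating a compact convex set from a closed convex cone turns
  preservation of semipositivity into a statement about rank one matrices
  (\<open>adjoint_maps_outer_to_outer\<close>): for all nonzero \<open>y, x \<ge> 0\<close> there are nonzero \<open>z, w \<ge> 0\<close> with
  \<open>G (y z\<^sup>T) = w x\<^sup>T\<close>.

  Now fix \<open>y\<close>. The image of \<open>{y z\<^sup>T | z}\<close> under \<open>G\<close> has dimension \<open>n\<close> and contains some \<open>w\<^sub>j e\<^sub>j\<^sup>T\<close> for
  each \<open>j\<close>, so these form a basis of it. It also contains some \<open>w 1\<^sup>T\<close>, where \<open>1\<close> is the all-ones
  vector, and comparing columns shows that every \<open>w\<^sub>j\<close> is a positive multiple of \<open>w\<close>. So the image is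
  exactly \<open>{w v\<^sup>T | v}\<close>, and \<open>G (y (R v)\<^sup>T) = w v\<^sup>T\<close> for a nonnegative invertible matrix \<open>R\<close>
  (\<open>common_left_factor\<close>). Here \<open>w\<close> and \<open>R\<close> depend on \<open>y\<close>; comparing the unit vectors \<open>y = e\<^sub>i\<close> with
  their sum \<open>y = 1\<close> in the same manner shows that up to positive scalars they all share one \<open>R\<close>
  (\<open>common_right_factor\<close>). Taking adjoints back, \<open>L A ** R = X ** A\<close>, where the rows of \<open>X\<close> are the
  rescaled vectors \<open>w\<close> belonging to the \<open>e\<^sub>i\<close>, and \<open>Y = R\<inverse>\<close>.
\<close>

section \<open>Rank one matrices and matrices with given columns\<close>

definition outer :: "real^'m \<Rightarrow> real^'n \<Rightarrow> real^'n^'m" where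
  "outer y z = (\<chi> i j. y $ i * z $ j)"

definition from_columns :: "('n \<Rightarrow> real^'m) \<Rightarrow> real^'n^'m" where
  "from_columns f = (\<chi> i j. f j $ i)"

lemma outer_nth [simp]: "outer y z $ i $ j = y $ i * z $ j"
  by (simp add: outer_def)

lemma outer_eq_0_iff: "outer y z = 0 \<longleftrightarrow> y = 0 \<or> z = 0"
  by (auto simp: vec_eq_iff)

lemma linear_outer_left: "linear (\<lambda>y. outer y z)"
  by (auto intro!: linearI simp: vec_eq_iff algebra_simps)

lemma linear_outer_right: "linear (outer y)"
  by (auto intro!: linearI simp: vec_eq_iff algebra_simps)

lemma inj_outer_right: "y \<noteq> 0 \<Longrightarrow> inj (outer y)"
  by (simp add: linear_injective_0[OF linear_outer_right] outer_eq_0_iff)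

text \<open>
  This identity lets inner products with rank one matrices express the sign conditions in the
  definition of semipositivity.
\<close>

lemma inner_outer: "A \<bullet> outer y z = y \<bullet> (A *v z)"
  by (simp add: inner_vec_def matrix_vector_mult_def sum_distrib_left mult_ac)

lemma from_columns_mult: "from_columns f *v c = (\<Sum>j\<in>UNIV. c $ j *\<^sub>R f j)"
  by (simp add: from_columns_def vec_eq_iff matrix_vector_mult_def mult.commute)

lemma invertible_if_trivial_kernel:
  fixes A :: "real^'n^'n"
  assumes "\<And>c. A *v c = 0 \<Longrightarrow> c = 0"
  shows "invertible A"
  using assms by (simp add: invertible_left_inverse matrix_left_invertible_ker)

lemma matrix_inv_cancel:
  assumes "invertible A"
  shows "A ** matrix_inv A = mat 1" "matrix_inv A ** A = mat 1"
  using someI_ex[OF assms[unfolded invertible_def]] by (auto simp: matrix_inv_def)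

lemma invertible_matrix_inv:
  assumes "invertible A"
  shows "invertible (matrix_inv A)"
  using matrix_inv_cancel[OF assms] by (auto simp: invertible_def)

lemma matrix_inv_matrix_inv:
  fixes A :: "real^'n^'n"
  assumes "invertible A"
  shows "matrix_inv (matrix_inv A) = A"
proof -
  let ?B = "matrix_inv A"
  have "matrix_inv ?B = (A ** ?B) ** matrix_inv ?B"
    by (simp add: matrix_inv_cancel[OF assms])
  also have "\<dots> = A ** (?B ** matrix_inv ?B)"
    by (simp only: matrix_mul_assoc)
  also have "\<dots> = A"
    by (simp add: matrix_inv_cancel[OF invertible_matrix_inv[OF assms]])
  finally show ?thesis .
qed

lemma from_columns_invertible:
  fixes f :: "'n \<Rightarrow> real^'n"
  assumes "\<And>c. (\<Sum>j\<in>UNIV. c j *\<^sub>R f j) = 0 \<Longrightarrow> \<forall>j. c j = 0"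
  shows "invertible (from_columns f)"
proof (rule invertible_if_trivial_kernel)
  fix c assume "from_columns f *v c = 0"
  then show "c = 0"
    using assms[of "($) c"] by (simp add: from_columns_mult vec_eq_iff)
qed

section \<open>The nonnegative orthant\<close>

text \<open>
  Linear algebra determines the scalars in the two factorization lemmas below only up to sign;
  this lemma makes them positive.
\<close>

lemma scale_pos_if_nonneg:
  fixes u v :: "real^'n"
  assumes "u = c *\<^sub>R v" "u \<noteq> 0" "u \<in> nonneg_orthant" "v \<in> nonneg_orthant"
  shows "c > 0"
proof -
  obtain i where i: "u $ i \<noteq> 0" using assms(2) by (auto simp: vec_eq_iff)
  then have "u $ i > 0" "v $ i \<ge> 0"
    using assms(3,4) by (auto simp: nonneg_orthant_def less_le)
  then show ?thesis using assms(1) by (simp add: zero_less_mult_iff)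
qed

lemma nonneg_matrix_mult:
  assumes "nonneg_matrix A" "x \<in> nonneg_orthant"
  shows "A *v x \<in> nonneg_orthant"
  using assms by (auto simp: nonneg_matrix_def nonneg_orthant_def matrix_vector_mult_def intro!: sum_nonneg)

lemma inner_nonneg_pos:
  assumes "y \<in> nonneg_orthant" "y \<noteq> 0" "x \<in> pos_orthant"
  shows "y \<bullet> x > 0"
proof -
  obtain i where i: "y $ i \<noteq> 0" using assms(2) by (auto simp: vec_eq_iff)
  show ?thesis unfolding inner_vec_def
  proof (rule sum_pos2[of _ i])
    show "0 < y $ i \<bullet> x $ i"
      using i assms by (auto simp: nonneg_orthant_def pos_orthant_def less_le)
  qed (use assms in \<open>auto simp: nonneg_orthant_def pos_orthant_def less_imp_le\<close>)
qed

lemma standard_simplex_nonneg: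
  assumes "w \<in> convex hull (range (\<lambda>i::'m::finite. axis i (1::real)))"
  shows "w \<in> nonneg_orthant" "w \<noteq> 0"
proof -
  let ?S = "{w :: real^'m::finite. (\<forall>i. 0 \<le> w $ i) \<and> (\<Sum>i\<in>UNIV. w $ i) = 1}"
  have "convex ?S"
    by (auto simp: convex_def sum.distrib simp flip: sum_distrib_left)
  moreover have "range (\<lambda>i::'m::finite. axis i (1::real)) \<subseteq> ?S"
    by (auto simp: axis_def)
  ultimately have "w \<in> ?S" using assms hull_minimal[of _ ?S convex] by blast
  then show "w \<in> nonneg_orthant" "w \<noteq> 0" by (auto simp: nonneg_orthant_def)
qed

lemma closed_nonneg_orthant: "closed (nonneg_orthant :: (real^'n) set)"
  unfolding nonneg_orthant_def
  by (intro closed_Collect_all closed_Collect_le continuous_intros)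

lemma convex_nonneg_orthant: "convex (nonneg_orthant :: (real^'n) set)"
  by (auto simp: convex_def nonneg_orthant_def)

section \<open>The adjoint on nonnegative rank one matrices\<close>

text \<open>
  The matrices \<open>w x\<^sup>T\<close>, with \<open>w\<close> in the standard simplex, form a compact convex set \<open>D\<close>; the matrices
  \<open>G (y z\<^sup>T)\<close> with \<open>z \<ge> 0\<close> form a closed convex cone \<open>E\<close>. If these were disjoint, a separating
  hyperplane would give a matrix \<open>A\<close> with \<open>(- A) x > 0\<close> but \<open>y\<^sup>T L (- A) z \<le> 0\<close> for all \<open>z \<ge> 0\<close>.
  Then \<open>- A\<close> is semipositive and \<open>L (- A)\<close> is not.
\<close>

lemma adjoint_maps_outer_to_outer:
  fixes L :: "real^'n^'m \<Rightarrow> real^'n^'m"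
  assumes "linear L" and "bij L" and L: "L ` semipositive_matrices \<subseteq> semipositive_matrices"
    and y: "y \<in> nonneg_orthant" "y \<noteq> 0" and x: "x \<in> nonneg_orthant" "x \<noteq> 0"
  shows "\<exists>z\<in>nonneg_orthant. \<exists>w\<in>nonneg_orthant. w \<noteq> 0 \<and>
           adjoint L (outer y z) = outer w x"
proof -
  let ?G = "adjoint L"
  define D where "D = (\<lambda>w. outer w x) ` (convex hull (range (\<lambda>i::'m::finite. axis i (1::real))))"
  define E where "E = (\<lambda>z. ?G (outer y z)) ` nonneg_orthant"
  have linG: "linear (\<lambda>z. ?G (outer y z))"
    using linear_compose[OF linear_outer_right adjoint_linear[OF \<open>linear L\<close>]] by (simp add: o_def)
  have "inj ?G"
    using inj_adjoint_iff_surj[OF \<open>linear L\<close>] \<open>bij L\<close> by (simp add: bij_def)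
  then have inj: "inj (\<lambda>z. ?G (outer y z))"
    using inj_compose[OF _ inj_outer_right[OF y(2)]] by (simp add: o_def)
  have "D \<inter> E \<noteq> {}"
  proof
    assume "D \<inter> E = {}"
    moreover have "compact D"
      unfolding D_def
      by (intro compact_continuous_image linear_continuous_on linear_outer_left[unfolded linear_conv_bounded_linear]
          compact_convex_hull finite_imp_compact) simp
    moreover have "convex D"
      unfolding D_def by (intro convex_linear_image linear_outer_left convex_convex_hull)
    moreover have "closed E"
      unfolding E_def by (intro closed_injective_linear_image closed_nonneg_orthant linG inj)
    moreover have "convex E"
      unfolding E_def by (intro convex_linear_image convex_nonneg_orthant linG)
    moreover have "D \<noteq> {}" by (simp add: D_def)
    ultimately obtain A b where A: "\<forall>d\<in>D. A \<bullet> d < b" "\<forall>e\<in>E. A \<bullet> e > b"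
      using separating_hyperplane_compact_closed[of D E] by blast
    have "0 \<in> E" unfolding E_def
      using linear_0[OF linG] by (auto simp: nonneg_orthant_def intro!: image_eqI[of _ _ 0])
    then have b: "b < 0" using A(2) by auto
    have pos: "(- A) *v x \<in> pos_orthant"
      unfolding pos_orthant_def
    proof clarify
      fix i
      have "outer (axis i 1) x \<in> D" unfolding D_def by (auto intro: hull_inc)
      then have "axis i 1 \<bullet> (A *v x) < 0" using A(1) b by (force simp: inner_outer)
      then show "0 < ((- A) *v x) $ i"
        by (simp add: inner_axis' matrix_vector_mult_def sum_negf)
    qed
    then have "L (- A) \<in> semipositive_matrices"
      using L x by (auto simp: semipositive_matrices_def semipositive_def)
    then obtain z where z: "z \<in> nonneg_orthant" "L (- A) *v z \<in> pos_orthant"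
      by (auto simp: semipositive_matrices_def semipositive_def)
    define t where "t = y \<bullet> (L (- A) *v z)"
    have "t > 0" unfolding t_def using inner_nonneg_pos[OF y z(2)] .
    \<comment> \<open>\<open>E\<close> is a cone, so \<open>z\<close> may be scaled until \<open>G (y z\<^sup>T)\<close> reaches the separating hyperplane.\<close>
    define r where "r = - b / t"
    have "r > 0" using b \<open>t > 0\<close> by (simp add: r_def divide_neg_pos)
    then have "r *\<^sub>R z \<in> nonneg_orthant" using z(1) by (simp add: nonneg_orthant_def)
    then have "b < A \<bullet> ?G (outer y (r *\<^sub>R z))" using A(2) by (auto simp: E_def)
    also have "\<dots> = r * (L A \<bullet> outer y z)"
      by (simp add: adjoint_clauses[OF \<open>linear L\<close>] linear_cmul[OF linear_outer_right])
    also have "L A \<bullet> outer y z = - t"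
      unfolding t_def by (simp add: linear_neg[OF \<open>linear L\<close>] flip: inner_outer)
    also have "r * - t = b" using \<open>t > 0\<close> by (simp add: r_def)
    finally show False by simp
  qed
  then obtain w z where "w \<in> convex hull (range (\<lambda>i::'m::finite. axis i (1::real)))"
      "z \<in> nonneg_orthant" "?G (outer y z) = outer w x"
    unfolding D_def E_def by fastforce
  then show ?thesis using standard_simplex_nonneg by blast
qed

section \<open>Factoring the adjoint\<close>

text \<open>
  The hypothesis is applied only to the unit vectors \<open>x = e\<^sub>j\<close> and to their sum, the all-ones vector.
  If \<open>G (y z\<^sub>j\<^sup>T) = w\<^sub>j e\<^sub>j\<^sup>T\<close>, then the \<open>z\<^sub>j\<close> are linearly independent because the \<open>w\<^sub>j e\<^sub>j\<^sup>T\<close> are. So the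
  vector \<open>z\<^sub>0\<close> with \<open>G (y z\<^sub>0\<^sup>T) = w\<^sub>0 1\<^sup>T\<close> is a combination of the \<open>z\<^sub>j\<close>, and its coefficients \<open>c\<^sub>j\<close> satisfy
  \<open>w\<^sub>0 = c\<^sub>j w\<^sub>j\<close>. The matrix \<open>R\<close> has the columns \<open>c\<^sub>j z\<^sub>j\<close>.
\<close>

lemma common_left_factor:
  fixes G :: "real^'n^'m \<Rightarrow> real^'n^'m"
  assumes "linear G" and "inj G" and y: "y \<noteq> 0"
    and G: "\<And>x. x \<in> nonneg_orthant \<Longrightarrow> x \<noteq> 0 \<Longrightarrow>
              \<exists>z\<in>nonneg_orthant. \<exists>w\<in>nonneg_orthant. w \<noteq> 0 \<and> G (outer y z) = outer w x"
  shows "\<exists>w\<in>nonneg_orthant. \<exists>R. w \<noteq> 0 \<and> nonneg_matrix R \<and> invertible R \<and>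
           (\<forall>v. G (outer y (R *v v)) = outer w v)"
proof -
  have linG: "linear (\<lambda>z. G (outer y z))"
    using linear_compose[OF linear_outer_right \<open>linear G\<close>] by (simp add: o_def)
  have "\<forall>j. \<exists>z\<in>nonneg_orthant. \<exists>w\<in>nonneg_orthant. w \<noteq> 0 \<and> G (outer y z) = outer w (axis j 1)"
    by (intro allI G) (auto simp: nonneg_orthant_def axis_def vec_eq_iff)
  then obtain z w where z: "\<And>j. z j \<in> nonneg_orthant"
    and w: "\<And>j. w j \<in> nonneg_orthant" "\<And>j. w j \<noteq> 0"
    and zw: "\<And>j. G (outer y (z j)) = outer (w j) (axis j 1)"
    by metis
  obtain z0 w0 where w0: "w0 \<in> nonneg_orthant" "w0 \<noteq> 0"
    and zw0: "G (outer y z0) = outer w0 (\<chi> j. 1)"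
    using G[of "\<chi> j. 1"] by (auto simp: nonneg_orthant_def vec_eq_iff)
  have comb: "G (outer y (\<Sum>j\<in>UNIV. c j *\<^sub>R z j)) $ i $ k = c k * w k $ i" for c i k
  proof -
    have "G (outer y (\<Sum>j\<in>UNIV. c j *\<^sub>R z j)) = (\<Sum>j\<in>UNIV. c j *\<^sub>R outer (w j) (axis j 1))"
      by (simp add: linear_sum[OF linG] linear_cmul[OF linG] zw)
    then show ?thesis
      by (simp add: axis_def if_distrib[of "\<lambda>t. _ * t"] cong: if_cong)
  qed
  have inv: "invertible (from_columns z)"
  proof (rule from_columns_invertible)
    fix c assume "(\<Sum>j\<in>UNIV. c j *\<^sub>R z j) = 0"
    then have "c k * w k $ i = 0" for k i
      using comb[of c i k] linear_0[OF linG] by simp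
    then show "\<forall>j. c j = 0" using w(2) by (metis mult_eq_0_iff vec_eq_iff zero_index)
  qed
  define c where "c = matrix_inv (from_columns z) *v z0"
  have "z0 = from_columns z *v c"
    using inv by (simp add: c_def matrix_vector_mul_assoc matrix_inv_cancel)
  then have w0_eq: "w0 = c $ k *\<^sub>R w k" for k
    using comb[of "($) c" _ k] zw0 by (simp add: vec_eq_iff[of w0] flip: from_columns_mult)
  have c_pos: "c $ k > 0" for k
    using scale_pos_if_nonneg[OF w0_eq w0(2) w0(1) w(1)] .
  define R where "R = from_columns (\<lambda>j. c $ j *\<^sub>R z j)"
  have "nonneg_matrix R"
    using z c_pos by (auto simp: R_def nonneg_matrix_def from_columns_def nonneg_orthant_def less_imp_le)
  moreover have eq: "G (outer y (R *v v)) = outer w0 v" for v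
  proof -
    have "G (outer y (R *v v)) $ i $ k = outer w0 v $ i $ k" for i k
      using comb[of "\<lambda>j. v $ j * c $ j" i k] by (subst w0_eq[of k]) (simp add: R_def from_columns_mult)
    then show ?thesis by (simp add: vec_eq_iff)
  qed
  moreover have "invertible R"
  proof (rule invertible_if_trivial_kernel)
    fix v assume "R *v v = 0"
    then have "outer w0 v = 0" using eq[of v] linear_0[OF linG] by simp
    then show "v = 0" using w0(2) by (simp add: outer_eq_0_iff)
  qed
  ultimately show ?thesis using w0 by blast
qed

text \<open>
  The same comparison in the other factor. Let \<open>w\<^sub>i, R\<^sub>i\<close> belong to \<open>y = e\<^sub>i\<close>, and \<open>w\<^sub>0, R\<^sub>0\<close> to
  \<open>y = 1\<close>. Injectivity of \<open>G\<close> makes the \<open>w\<^sub>i\<close> a basis, so \<open>w\<^sub>0 = \<Sum>\<^sub>i a\<^sub>i w\<^sub>i\<close>; the matrix with rows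
  \<open>a\<^sub>i R\<^sub>i v\<close> then has the same image \<open>w\<^sub>0 v\<^sup>T\<close> as \<open>1 (R\<^sub>0 v)\<^sup>T\<close>, which gives \<open>R\<^sub>0 = a\<^sub>i R\<^sub>i\<close> for all \<open>i\<close>.
  The rows of \<open>X\<close> are the vectors \<open>a\<^sub>i w\<^sub>i\<close>.
\<close>

lemma common_right_factor:
  fixes G :: "real^'n^'m \<Rightarrow> real^'n^'m"
  assumes "linear G" and "inj G"
    and G: "\<And>y. y \<in> nonneg_orthant \<Longrightarrow> y \<noteq> 0 \<Longrightarrow>
              \<exists>w\<in>nonneg_orthant. \<exists>R. w \<noteq> 0 \<and> nonneg_matrix R \<and> invertible R \<and>
                (\<forall>v. G (outer y (R *v v)) = outer w v)"
  shows "\<exists>(X :: real^'m^'m) R. invertible X \<and> nonneg_matrix X \<and> invertible R \<and> nonneg_matrix R \<and>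
           (\<forall>i v. G (outer (axis i 1) (R *v v)) = outer (X $ i) v)"
proof -
  have "\<forall>i. \<exists>w\<in>nonneg_orthant. \<exists>R. w \<noteq> 0 \<and> nonneg_matrix R \<and> invertible R \<and>
                (\<forall>v. G (outer (axis i 1) (R *v v)) = outer w v)"
    by (intro allI G) (auto simp: nonneg_orthant_def axis_def vec_eq_iff)
  then obtain w R where w: "\<And>i. w i \<in> nonneg_orthant" "\<And>i. w i \<noteq> 0"
    and R: "\<And>i. nonneg_matrix (R i)" "\<And>i. invertible (R i)"
    and wR: "\<And>i v. G (outer (axis i 1) (R i *v v)) = outer (w i) v"
    by metis
  obtain w0 R0 where w0: "w0 \<in> nonneg_orthant" "w0 \<noteq> 0"
    and R0: "nonneg_matrix R0" "invertible R0"
    and wR0: "\<And>v. G (outer (\<chi> i. 1) (R0 *v v)) = outer w0 v"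
    using G[of "\<chi> i. 1"] by (auto simp: nonneg_orthant_def vec_eq_iff)
  have comb: "G (\<chi> i. c i *\<^sub>R (R i *v v)) = outer (\<Sum>i\<in>UNIV. c i *\<^sub>R w i) v" for c v
  proof -
    have "(\<chi> i. c i *\<^sub>R (R i *v v)) = (\<Sum>i\<in>UNIV. c i *\<^sub>R outer (axis i 1) (R i *v v))"
      by (simp add: vec_eq_iff axis_def if_distrib[of "\<lambda>t. t * _"] if_distrib[of "\<lambda>t. _ * t"] cong: if_cong)
    then show ?thesis
      by (simp add: linear_sum[OF \<open>linear G\<close>] linear_cmul[OF \<open>linear G\<close>] wR
          linear_sum[OF linear_outer_left] linear_cmul[OF linear_outer_left])
  qed
  \<comment> \<open>Any nonzero nonnegative vector serves to detect zero coefficients and signs.\<close>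
  define v0 :: "real^'n" where "v0 = (\<chi> j. 1)"
  have v0: "v0 \<in> nonneg_orthant" "v0 \<noteq> 0" by (auto simp: v0_def nonneg_orthant_def vec_eq_iff)
  have ker: "A *v v0 \<noteq> 0" if "invertible A" for A :: "real^'n^'n"
    using that v0(2) by (metis invertible_left_inverse matrix_left_invertible_ker)
  have indep: "\<forall>i. c i = 0" if "(\<Sum>i\<in>UNIV. c i *\<^sub>R w i) = 0" for c
  proof -
    have "G (\<chi> i. c i *\<^sub>R (R i *v v0)) = G 0"
      using comb[of c v0] that by (simp add: linear_0[OF \<open>linear G\<close>] outer_eq_0_iff)
    then have "(\<chi> i. c i *\<^sub>R (R i *v v0)) = 0" using \<open>inj G\<close> by (simp add: inj_eq)
    then have "(\<chi> i. c i *\<^sub>R (R i *v v0)) $ i = 0" for i by (simp only: zero_index)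
    then have "c i *\<^sub>R (R i *v v0) = 0" for i by simp
    then show ?thesis using ker[OF R(2)] by simp
  qed
  have inv: "invertible (from_columns w)"
    using indep by (rule from_columns_invertible)
  define a where "a = matrix_inv (from_columns w) *v w0"
  have "w0 = from_columns w *v a"
    using inv by (simp add: a_def matrix_vector_mul_assoc matrix_inv_cancel)
  then have w0_eq: "w0 = (\<Sum>i\<in>UNIV. a $ i *\<^sub>R w i)" by (simp add: from_columns_mult)
  have R0_eq: "R0 *v v = a $ i *\<^sub>R (R i *v v)" for i v
  proof -
    have "G (\<chi> i. a $ i *\<^sub>R (R i *v v)) = G (outer (\<chi> i. 1) (R0 *v v))"
      by (simp add: comb wR0 w0_eq)
    then have "(\<chi> i. a $ i *\<^sub>R (R i *v v)) = outer (\<chi> i. 1) (R0 *v v)"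
      using \<open>inj G\<close> by (simp add: inj_eq)
    then show ?thesis by (simp add: vec_eq_iff)
  qed
  have a_pos: "a $ i > 0" for i
    by (rule scale_pos_if_nonneg[OF R0_eq ker[OF R0(2)]])
       (auto intro: nonneg_matrix_mult v0 R0 R)
  define X :: "real^'m^'m" where "X = (\<chi> i. a $ i *\<^sub>R w i)"
  have "transpose X = from_columns (\<lambda>i. a $ i *\<^sub>R w i)"
    by (simp add: X_def transpose_def from_columns_def)
  moreover have "invertible (from_columns (\<lambda>i. a $ i *\<^sub>R w i))"
  proof (rule from_columns_invertible)
    fix c assume "(\<Sum>i\<in>UNIV. c i *\<^sub>R a $ i *\<^sub>R w i) = 0"
    then have "\<forall>i. c i * a $ i = 0" using indep[of "\<lambda>i. c i * a $ i"] by simp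
    then show "\<forall>i. c i = 0" using a_pos by (metis less_irrefl mult_eq_0_iff)
  qed
  ultimately have "invertible X" by (metis transpose_invertible transpose_transpose)
  moreover have "nonneg_matrix X"
    using a_pos w(1) by (auto simp: X_def nonneg_matrix_def nonneg_orthant_def less_imp_le)
  moreover have "G (outer (axis i 1) (R0 *v v)) = outer (X $ i) v" for i v
  proof -
    have "G (outer (axis i 1) (R0 *v v)) = a $ i *\<^sub>R outer (w i) v"
      unfolding R0_eq[of v i] linear_cmul[OF linear_outer_right] linear_cmul[OF \<open>linear G\<close>] wR ..
    then show ?thesis by (simp add: X_def linear_cmul[OF linear_outer_left])
  qed
  ultimately show ?thesis using R0 by blast
qed

section \<open>Maps preserving semipositivity\<close>

lemma row_positive_if_invertible:
  assumes "invertible X" "nonneg_matrix X"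
  shows "row_positive X"
  unfolding row_positive_def
proof (intro conjI allI)
  fix i
  have "row i X \<noteq> 0" using assms(1) det_zero_row(2)[of i X] by (auto simp: invertible_det_nz)
  then show "\<exists>j. X $ i $ j \<noteq> 0" by (auto simp: row_def vec_eq_iff)
qed (fact assms)

lemma semipositive_preserver_form:
  fixes L :: "real^'n^'m \<Rightarrow> real^'n^'m"
  assumes "linear L" and "bij L" and L: "L ` semipositive_matrices \<subseteq> semipositive_matrices"
  shows "\<exists>(X :: real^'m^'m) (Y :: real^'n^'n).
           invertible X \<and> invertible Y \<and> row_positive X \<and> inverse_nonnegative Y \<and>
           (\<forall>A. L A = X ** A ** Y)"
proof -
  have lin: "linear (adjoint L)" using \<open>linear L\<close> by (rule adjoint_linear)
  have inj: "inj (adjoint L)"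
    using inj_adjoint_iff_surj[OF \<open>linear L\<close>] \<open>bij L\<close> by (simp add: bij_def)
  obtain X :: "real^'m^'m" and R :: "real^'n^'n"
    where X: "invertible X" "nonneg_matrix X" and R: "invertible R" "nonneg_matrix R"
      and XR: "\<And>i v. adjoint L (outer (axis i 1) (R *v v)) = outer (X $ i) v"
    using common_right_factor[OF lin inj common_left_factor[OF lin inj _
          adjoint_maps_outer_to_outer[OF assms]]] by blast
  \<comment> \<open>Entry \<open>i\<close> of \<open>L A R v\<close> is an inner product of \<open>L A\<close> with \<open>e\<^sub>i (R v)\<^sup>T\<close>, so it is computed by the adjoint.\<close>
  have "L A ** R = X ** A" for A
  proof -
    have "((L A ** R) *v v) $ i = ((X ** A) *v v) $ i" for v i
    proof -
      have "((L A ** R) *v v) $ i = L A \<bullet> outer (axis i 1) (R *v v)"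
        by (simp add: inner_outer inner_axis' matrix_vector_mul_assoc)
      also have "\<dots> = X $ i \<bullet> (A *v v)"
        by (metis XR adjoint_works[OF \<open>linear L\<close>] inner_outer)
      also have "\<dots> = ((X ** A) *v v) $ i"
        by (simp add: matrix_vector_mul_component flip: matrix_vector_mul_assoc)
      finally show ?thesis .
    qed
    then show ?thesis by (simp add: matrix_eq vec_eq_iff)
  qed
  then have "L A = X ** A ** matrix_inv R" for A
    using matrix_mul_assoc[of "L A" R "matrix_inv R"] by (simp add: matrix_inv_cancel[OF R(1)])
  moreover have "invertible (matrix_inv R)"
    using R(1) by (rule invertible_matrix_inv)
  moreover from this have "inverse_nonnegative (matrix_inv R)"
    unfolding inverse_nonnegative_def matrix_inv_matrix_inv[OF R(1)] using R(2) by (rule conjI)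
  ultimately show ?thesis
    using X(1) row_positive_if_invertible[OF X] by blast
qed

lemma row_positive_mult_pos:
  assumes "row_positive X" "u \<in> pos_orthant"
  shows "X *v u \<in> pos_orthant"
  unfolding pos_orthant_def
proof clarify
  fix i
  have "X $ i \<in> nonneg_orthant" "X $ i \<noteq> 0"
    using assms(1) by (auto simp: row_positive_def nonneg_matrix_def nonneg_orthant_def vec_eq_iff)
  then show "0 < (X *v u) $ i"
    using inner_nonneg_pos assms(2) by (simp add: matrix_vector_mul_component)
qed

lemma semipositive_mult:
  assumes "row_positive X" "inverse_nonnegative Y" "semipositive A"
  shows "semipositive (X ** A ** Y)"
proof -
  obtain x where x: "x \<in> nonneg_orthant" "A *v x \<in> pos_orthant"
    using assms(3) by (auto simp: semipositive_def)
  have Y: "invertible Y" "nonneg_matrix (matrix_inv Y)"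
    using assms(2) by (auto simp: inverse_nonnegative_def)
  have "X ** A ** Y *v (matrix_inv Y *v x) = (X ** A) *v ((Y ** matrix_inv Y) *v x)"
    by (simp only: matrix_vector_mul_assoc matrix_mul_assoc)
  also have "\<dots> = X *v (A *v x)"
    by (simp only: matrix_inv_cancel[OF Y(1)] matrix_vector_mul_lid matrix_vector_mul_assoc)
  finally have "X ** A ** Y *v (matrix_inv Y *v x) = X *v (A *v x)" .
  then have "X ** A ** Y *v (matrix_inv Y *v x) \<in> pos_orthant"
    using row_positive_mult_pos[OF assms(1) x(2)] by simp
  then show ?thesis
    using nonneg_matrix_mult[OF Y(2) x(1)] by (auto simp: semipositive_def)
qed

theorem theorem1p2:
  assumes "CARD('m::finite) \<ge> 2" and "CARD('n::finite) \<ge> 2"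
  shows "(\<forall>L :: real^'n^'m \<Rightarrow> real^'n^'m.
            linear L \<and> bij L \<and> L ` semipositive_matrices \<subseteq> semipositive_matrices \<longrightarrow>
            (\<exists>(X :: real^'m^'m) (Y :: real^'n^'n).
               invertible X \<and> invertible Y \<and> row_positive X \<and> inverse_nonnegative Y \<and>
               (\<forall>A. L A = X ** A ** Y)))
       \<and> (\<forall>(L :: real^'n^'m \<Rightarrow> real^'n^'m) (X :: real^'m^'m) (Y :: real^'n^'n).
            invertible X \<and> row_positive X \<and> inverse_nonnegative Y \<and>
            (\<forall>A. L A = X ** A ** Y) \<longrightarrow>
            L ` semipositive_matrices \<subseteq> semipositive_matrices)"
proof (intro conjI allI impI)
  fix L :: "real^'n^'m \<Rightarrow> real^'n^'m"
  assume "linear L \<and> bij L \<and> L ` semipositive_matrices \<subseteq> semipositive_matrices"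
  then show "\<exists>(X :: real^'m^'m) (Y :: real^'n^'n).
      invertible X \<and> invertible Y \<and> row_positive X \<and> inverse_nonnegative Y \<and>
      (\<forall>A. L A = X ** A ** Y)"
    by (elim conjE) (rule semipositive_preserver_form)
next
  fix L :: "real^'n^'m \<Rightarrow> real^'n^'m" and X :: "real^'m^'m" and Y :: "real^'n^'n"
  assume LXY: "invertible X \<and> row_positive X \<and> inverse_nonnegative Y \<and> (\<forall>A. L A = X ** A ** Y)"
  show "L ` semipositive_matrices \<subseteq> semipositive_matrices"
  proof (rule image_subsetI)
    fix A :: "real^'n^'m" assume "A \<in> semipositive_matrices"
    then have "semipositive (X ** A ** Y)"
      using LXY by (intro semipositive_mult) (auto simp: semipositive_matrices_def)
    then show "L A \<in> semipositive_matrices"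
      using LXY by (simp add: semipositive_matrices_def)
  qed
qed

end
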